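(* The local truncation error of the DLN method is the differentiation error ${\cal L}_d$ (defined in the context), and $${\cal L}_d\big(y(t),t_{n+1},k_n\big)\approx\frac{y'''(t_n)}{2}\Big[\frac{1}{3\widehat{k}_n}\Big(k_n^3-\frac{\alpha_0}{\alpha_2}k_{n-1}^3\Big)-\frac{1}{\alpha_2}\big(\beta_2^{(n)}k_n-\beta_0^{(n)}k_{n-1}\big)^2\Big].$$
   Context: Here $y$ is the solution of the initial value problem $y'(t)=f(t,y(t))$, $y(0)=y_0$, approximated at times $\{t_n\}_{n\ge0}$ with time steps $k_n=t_{n+1}-t_n$, and $\varepsilon_n=(k_n-k_{n-1})/(k_n+k_{n-1})$ is the step size variability. For an arbitrary parameter $\delta\in[0,1]$: $$\alpha_2=\tfrac12(\delta+1),\qquad \alpha_1=-\delta,\qquad \alpha_0=\tfrac12(\delta-1),$$ $$\beta_2^{(n)}=\tfrac14\Big(1+\tfrac{1-\delta^2}{(1+\varepsilon_n\delta)^2}+\varepsilon_n^2\tfrac{\delta(1-\delta^2)}{(1+\varepsilon_n\delta)^2}+\delta\Big),\qquad \beta_1^{(n)}=\tfrac12\Big(1-\tfrac{1-\delta^2}{(1+\varepsilon_n\delta)^2}\Big),$$ $$\beta_0^{(n)}=\tfrac14\Big(1+\tfrac{1-\delta^2}{(1+\varepsilon_n\delta)^2}-\varepsilon_n^2\tfrac{\delta(1-\delta^2)}{(1+\varepsilon_n\delta)^2}-\delta\Big),$$ and the average step size is $\widehat{k}_n=\alpha_2k_n-\alpha_0k_{n-1}$. The DLN (Dahlquist–Liniger–Nevanlinna)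 method is the variable step, one-leg, two-step method $$\frac{\alpha_2y_{n+1}+\alpha_1y_n+\alpha_0y_{n-1}}{\widehat{k}_n}=f\Big(t_{n,\beta},\ \beta_2^{(n)}y_{n+1}+\beta_1^{(n)}y_n+\beta_0^{(n)}y_{n-1}\Big),\qquad t_{n,\beta}=\beta_2^{(n)}t_{n+1}+\beta_1^{(n)}t_n+\beta_0^{(n)}t_{n-1}.$$ The differentiation error (differentiation defect) is $${\cal L}_d\big(y(t),t_{n+1},k_n\big)=\frac1{\widehat{k}_n}\sum_{\ell=0}^2\alpha_\ell\,y(t_{n-1+\ell})-f\big(t_{n,\beta},y(t_{n,\beta})\big).$$ By contrast, the classical definition of the local truncation error is the sum of ${\cal L}_d$ and the interpolation defect ${\cal L}_i=f\big(t_{n,\beta},y(t_{n,\beta})\big)-f\big(t_{n,\beta},\sum_{\ell=0}^2\beta_\ell^{(n)}y(t_{n-1+\ell})\big)$. The symbol $\approx$ indicates that the right-hand side is presented as the leading term obtained by Taylor expansions.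
   Formalization: The printed right-hand side is off by the factor α_2 (δ=0, constant step k, y=t^3: L_d=k^2 but the formula gives 2k^2); the formal statement multiplies it by α_2. The sign ≈ is read as an error small relative to the bracket, for y of class C^3 on [0,T]. *)

theory Defs
  imports "HOL-Analysis.Analysis"
begin

definition ivp_solution ::
  "(real \<Rightarrow> 'a::real_normed_vector \<Rightarrow> 'a) \<Rightarrow> 'a \<Rightarrow> real \<Rightarrow> (real \<Rightarrow> 'a) \<Rightarrow> bool" where
  "ivp_solution f y0 T y \<longleftrightarrow>
     y 0 = y0 \<and> (\<forall>s\<in>{0..T}. (y has_vector_derivative f s (y s)) (at s within {0..T}))"

definition time_step :: "(nat \<Rightarrow> real) \<Rightarrow> nat \<Rightarrow> real" where
  "time_step t n = t (n + 1) - t n"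

text \<open>Everything below that involves \<open>n - 1\<close> is meant for \<open>n \<ge> 1\<close>.\<close>

definition step_variability :: "(nat \<Rightarrow> real) \<Rightarrow> nat \<Rightarrow> real" where
  "step_variability t n =
     (time_step t n - time_step t (n - 1)) / (time_step t n + time_step t (n - 1))"

text \<open>The second argument of the coefficients is the index \<open>l \<in> {0, 1, 2}\<close>.\<close>

definition dln_alpha :: "real \<Rightarrow> nat \<Rightarrow> real" where
  "dln_alpha \<delta> l =
     (if l = 2 then (\<delta> + 1) / 2 else if l = 1 then - \<delta> else (\<delta> - 1) / 2)"

definition dln_beta :: "real \<Rightarrow> (nat \<Rightarrow> real) \<Rightarrow> nat \<Rightarrow> nat \<Rightarrow> real" where
  "dln_beta \<delta> t n l =
     (let \<epsilon> = step_variability t n;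
          q = (1 - \<delta>\<^sup>2) / (1 + \<epsilon> * \<delta>)\<^sup>2;
          r = \<epsilon>\<^sup>2 * (\<delta> * (1 - \<delta>\<^sup>2) / (1 + \<epsilon> * \<delta>)\<^sup>2)
      in if l = 2 then (1 + q + r + \<delta>) / 4
         else if l = 1 then (1 - q) / 2
         else (1 + q - r - \<delta>) / 4)"

definition avg_step :: "real \<Rightarrow> (nat \<Rightarrow> real) \<Rightarrow> nat \<Rightarrow> real" where
  "avg_step \<delta> t n = dln_alpha \<delta> 2 * time_step t n - dln_alpha \<delta> 0 * time_step t (n - 1)"

definition dln_time :: "real \<Rightarrow> (nat \<Rightarrow> real) \<Rightarrow> nat \<Rightarrow> real" where
  "dln_time \<delta> t n = (\<Sum>l\<le>2. dln_beta \<delta> t n l * t (n - 1 + l))"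

text \<open>Residual of the DLN equation for grid values \<open>Y\<close> and one-leg argument \<open>v\<close>.
  The method is the requirement that it vanishes for
  \<open>v = (\<Sum>l\<le>2. dln_beta \<delta> t n l *\<^sub>R Y (n - 1 + l))\<close>.\<close>

definition dln_residual ::
  "real \<Rightarrow> (real \<Rightarrow> 'a::real_vector \<Rightarrow> 'a) \<Rightarrow> (nat \<Rightarrow> real) \<Rightarrow> nat \<Rightarrow> (nat \<Rightarrow> 'a) \<Rightarrow> 'a \<Rightarrow> 'a" where
  "dln_residual \<delta> f t n Y v =
     (\<Sum>l\<le>2. dln_alpha \<delta> l *\<^sub>R Y (n - 1 + l)) /\<^sub>R avg_step \<delta> t n - f (dln_time \<delta> t n) v"

text \<open>The local truncation error inserts the exact solution, also in the one-leg argument.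
  The classical definition takes instead the interpolated value
  \<open>(\<Sum>l\<le>2. dln_beta \<delta> t n l *\<^sub>R y (t (n - 1 + l)))\<close> as one-leg argument,
  which adds the interpolation defect.\<close>

definition dln_lte ::
  "real \<Rightarrow> (real \<Rightarrow> 'a::real_vector \<Rightarrow> 'a) \<Rightarrow> (real \<Rightarrow> 'a) \<Rightarrow> (nat \<Rightarrow> real) \<Rightarrow> nat \<Rightarrow> 'a" where
  "dln_lte \<delta> f y t n = dln_residual \<delta> f t n (\<lambda>m. y (t m)) (y (dln_time \<delta> t n))"

definition diff_defect ::
  "real \<Rightarrow> (real \<Rightarrow> 'a::real_vector \<Rightarrow> 'a) \<Rightarrow> (real \<Rightarrow> 'a) \<Rightarrow> (nat \<Rightarrow> real) \<Rightarrow> nat \<Rightarrow> 'a" where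
  "diff_defect \<delta> f y t n =
     (1 / avg_step \<delta> t n) *\<^sub>R (\<Sum>l\<le>2. dln_alpha \<delta> l *\<^sub>R y (t (n - 1 + l)))
       - f (dln_time \<delta> t n) (y (dln_time \<delta> t n))"

text \<open>This bracket belongs to the defect normalized by the leading coefficient \<open>\<alpha>\<^sub>2\<close>:
  the leading term of \<open>diff_defect\<close> is \<open>\<alpha>\<^sub>2\<close> times \<open>dln_bracket / 2\<close> times the third derivative.
  For \<open>\<delta> = 0\<close>, uniform step \<open>k\<close> and \<open>y s = s ^ 3\<close>, say, the defect is \<open>k\<^sup>2\<close>
  and the bracket is \<open>2 * k\<^sup>2 / 3\<close>.

  For positive steps, \<open>\<alpha>\<^sub>2\<close> times the bracket lies between
  \<open>Q / 12\<close> and \<open>Q / 3\<close>, where \<open>Q\<close> is the mean of \<open>k\<^sub>n\<^sup>2\<close> and \<open>k\<^sub>n\<^sub>-\<^sub>1\<^sup>2\<close> with weights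
  \<open>\<alpha>\<^sub>2 k\<^sub>n\<close> and \<open>- \<alpha>\<^sub>0 k\<^sub>n\<^sub>-\<^sub>1\<close>. So an error that is small relative to the bracket is of
  higher order in the step sizes.\<close>

definition dln_bracket :: "real \<Rightarrow> (nat \<Rightarrow> real) \<Rightarrow> nat \<Rightarrow> real" where
  "dln_bracket \<delta> t n =
     1 / (3 * avg_step \<delta> t n) *
       (time_step t n ^ 3 - dln_alpha \<delta> 0 / dln_alpha \<delta> 2 * time_step t (n - 1) ^ 3)
     - 1 / dln_alpha \<delta> 2 *
       (dln_beta \<delta> t n 2 * time_step t n - dln_beta \<delta> t n 0 * time_step t (n - 1))\<^sup>2"

end

theory Submission
  imports Defs
begin

text \<open>Taylor expansion at \<open>t\<^sub>n\<close> turns both the difference quotient and \<open>y'(t\<^sub>n\<^sub>,\<^sub>\<beta>)\<close> into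
  polynomials in the steps. Their second order terms agree because of
  \<open>t\<^sub>n\<^sub>,\<^sub>\<beta> - t\<^sub>n = (\<alpha>\<^sub>2 k\<^sub>n\<^sup>2 + \<alpha>\<^sub>0 k\<^sub>n\<^sub>-\<^sub>1\<^sup>2) / (2 k)\<close>, where \<open>k\<close> is the average step size. The same identity and
  the Cauchy--Schwarz inequality bound \<open>(t\<^sub>n\<^sub>,\<^sub>\<beta> - t\<^sub>n)\<^sup>2\<close> by a quarter of
  \<open>Q = (\<alpha>\<^sub>2 k\<^sub>n\<^sup>3 - \<alpha>\<^sub>0 k\<^sub>n\<^sub>-\<^sub>1\<^sup>3) / k\<close>, so that \<open>Q\<close>, and with it every remainder, is controlled by the bracket.
  Uniform continuity of the third derivative makes the remainders small uniformly in \<open>t\<^sub>n\<close>.\<close>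

text \<open>Induction on the order: differentiating the remainder of order \<open>Suc n\<close>
  gives the remainder of order \<open>n\<close> for the chain shifted by one, and the mean value
  inequality on the segment from \<open>t\<close> to \<open>x\<close> supplies one more factor
  \<open>\<bar>x - t\<bar>\<close>. The polynomial includes the term of degree \<open>n\<close>, so
  the bound involves only the oscillation of the top derivative.\<close>

lemma Taylor_bound_convex:
  fixes D :: "nat \<Rightarrow> real \<Rightarrow> 'a::real_normed_vector"
  assumes "convex S" and "t \<in> S" and "x \<in> S"
    and "\<And>i s. i < n \<Longrightarrow> s \<in> S \<Longrightarrow>
           (D i has_vector_derivative D (Suc i) s) (at s within S)"
    and "\<And>s. s \<in> S \<Longrightarrow> norm (D n s - D n t) \<le> M"
  shows "norm (D 0 x - (\<Sum>i\<le>n. ((x - t) ^ i / fact i) *\<^sub>R D i t)) \<le> M * \<bar>x - t\<bar> ^ n"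
  using assms(3-)
proof (induction n arbitrary: D x)
  case 0
  then show ?case by simp
next
  case (Suc n)
  define g where "g s = D 0 s - (\<Sum>i\<le>Suc n. ((s - t) ^ i / fact i) *\<^sub>R D i t)" for s
  define g' where "g' s = D 1 s - (\<Sum>i\<le>n. ((s - t) ^ i / fact i) *\<^sub>R D (Suc i) t)" for s
  have sub: "closed_segment t x \<subseteq> S"
    using \<open>convex S\<close> \<open>t \<in> S\<close> Suc.prems(1) by (simp add: closed_segment_subset)
  \<comment> \<open>With the constant term split off, every remaining power has exponent
    \<open>Suc i\<close>, and its derivative cancels one factor of the factorial.\<close>
  have g_eq: "g = (\<lambda>s. D 0 s - (D 0 t + (\<Sum>i\<le>n. ((s - t) ^ Suc i / fact (Suc i)) *\<^sub>R D (Suc i) t)))"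
    unfolding g_def by (subst sum.atMost_Suc_shift) simp
  have deriv: "(g has_vector_derivative g' s) (at s within closed_segment t x)"
    if "s \<in> closed_segment t x" for s
  proof -
    have "((\<lambda>s. ((s - t) ^ Suc i / fact (Suc i)) *\<^sub>R D (Suc i) t) has_vector_derivative
        ((s - t) ^ i / fact i) *\<^sub>R D (Suc i) t) (at s within closed_segment t x)" for i
    proof -
      have "((\<lambda>s. (s - t) ^ Suc i / fact (Suc i)) has_real_derivative
          real (Suc i) * (s - t) ^ i / fact (Suc i)) (at s within closed_segment t x)"
        by (rule DERIV_cdivide) (auto intro!: derivative_eq_intros simp del: power_Suc)
      then have "((\<lambda>s. (s - t) ^ Suc i / fact (Suc i)) has_real_derivative (s - t) ^ i / fact i)
          (at s within closed_segment t x)"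
        by (simp add: fact_Suc del: power_Suc of_nat_Suc)
      from has_vector_derivative_scaleR[OF this has_vector_derivative_const] show ?thesis
        by simp
    qed
    note polynomial = has_vector_derivative_add[OF has_vector_derivative_const
        has_vector_derivative_sum[OF this]]
    have "(D 0 has_vector_derivative D (Suc 0) s) (at s within closed_segment t x)"
      using Suc.prems(2)[of 0 s] that sub has_vector_derivative_within_subset by fastforce
    from has_vector_derivative_diff[OF this polynomial] show ?thesis
      unfolding g_eq g'_def by simp
  qed
  have bound: "norm (g' s) \<le> M * \<bar>x - t\<bar> ^ n" if "s \<in> closed_segment t x" for s
  proof -
    have "norm (g' s) \<le> M * \<bar>s - t\<bar> ^ n"
      using Suc.IH[of s "\<lambda>i. D (Suc i)"] Suc.prems(2,3) that sub by (auto simp: g'_def)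
    moreover have "\<bar>s - t\<bar> \<le> \<bar>x - t\<bar>"
      using that by (auto simp: closed_segment_eq_real_ivl split: if_splits)
    moreover have "0 \<le> M"
      using Suc.prems(3)[OF \<open>t \<in> S\<close>] by simp
    ultimately show ?thesis
      by (meson mult_left_mono order_trans power_mono abs_ge_zero)
  qed
  have "norm (g x - g t) \<le> (M * \<bar>x - t\<bar> ^ n) * norm (x - t)"
  proof (rule differentiable_bound[of "closed_segment t x"])
    show "(g has_derivative (\<lambda>h. h *\<^sub>R g' s)) (at s within closed_segment t x)"
      if "s \<in> closed_segment t x" for s
      using deriv[OF that] by (simp add: has_vector_derivative_def)
    show "onorm (\<lambda>h. h *\<^sub>R g' s) \<le> M * \<bar>x - t\<bar> ^ n" if "s \<in> closed_segment t x" for s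
      using bound[OF that] by (intro onorm_le) (simp add: mult.commute mult_left_mono)
  qed auto
  moreover have "g t = 0"
    by (simp add: g_eq)
  ultimately show ?case
    by (simp add: g_def mult_ac)
qed

lemma sum_le_2: "(\<Sum>l\<le>2. g l) = g 0 + g 1 + g (2::nat)"
  for g :: "nat \<Rightarrow> 'a::comm_monoid_add"
  by (simp add: numeral_2_eq_2)

lemma dln_beta_sum: "dln_beta \<delta> t n 0 + dln_beta \<delta> t n 1 + dln_beta \<delta> t n 2 = 1"
  by (simp add: dln_beta_def Let_def field_split_simps)

lemma dln_time_eq:
  assumes "n \<ge> 1"
  shows "dln_time \<delta> t n =
    t n + (dln_beta \<delta> t n 2 * time_step t n - dln_beta \<delta> t n 0 * time_step t (n - 1))"
proof -
  have "dln_beta \<delta> t n 1 = 1 - dln_beta \<delta> t n 0 - dln_beta \<delta> t n 2"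
    using dln_beta_sum[of \<delta> t n] by linarith
  with assms show ?thesis
    unfolding dln_time_def sum_le_2 time_step_def by (simp add: left_diff_distrib right_diff_distrib)
qed

lemma avg_step_pos:
  assumes "0 \<le> \<delta>" "\<delta> \<le> 1" "time_step t n > 0" "time_step t (n - 1) > 0"
  shows "avg_step \<delta> t n > 0"
proof -
  have "(\<delta> + 1) / 2 * time_step t n > 0" "(1 - \<delta>) / 2 * time_step t (n - 1) \<ge> 0"
    using assms by auto
  then show ?thesis
    unfolding avg_step_def dln_alpha_def by (simp add: algebra_simps)
qed

text \<open>This is the second order condition. In terms of the mean step \<open>s\<close> and the
  variability \<open>\<epsilon>\<close>, the steps are \<open>s * (1 + \<epsilon>)\<close> and
  \<open>s * (1 - \<epsilon>)\<close>, and the average step is \<open>s * u\<close> with the same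
  \<open>u = 1 + \<epsilon> * \<delta>\<close> that occurs squared in the denominators of the
  coefficients.\<close>

lemma dln_offset:
  assumes "0 \<le> \<delta>" "\<delta> \<le> 1" "time_step t n > 0" "time_step t (n - 1) > 0"
  shows "dln_beta \<delta> t n 2 * time_step t n - dln_beta \<delta> t n 0 * time_step t (n - 1) =
    (dln_alpha \<delta> 2 * time_step t n ^ 2 + dln_alpha \<delta> 0 * time_step t (n - 1) ^ 2)
      / (2 * avg_step \<delta> t n)"
proof -
  define k m \<epsilon> where "k = time_step t n" and "m = time_step t (n - 1)" and "\<epsilon> = step_variability t n"
  define s where "s = (k + m) / 2"
  define u where "u = 1 + \<epsilon> * \<delta>"
  have s: "s > 0" using assms by (simp add: s_def k_def m_def)
  have "\<epsilon> * (k + m) = k - m"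
    using s unfolding \<epsilon>_def step_variability_def k_def[symmetric] m_def[symmetric]
    by (simp add: s_def)
  then have k: "k = s * (1 + \<epsilon>)" and m: "m = s * (1 - \<epsilon>)"
    by (simp_all add: s_def field_simps)
  have avg: "avg_step \<delta> t n = s * u"
    unfolding avg_step_def k_def[symmetric] m_def[symmetric] k m u_def
    by (simp add: dln_alpha_def field_simps)
  then have u: "u > 0"
    using avg_step_pos[OF assms] s by (simp add: zero_less_mult_iff)
  define q where "q = (1 - \<delta>\<^sup>2) / u\<^sup>2"
  have qu: "q * u\<^sup>2 = 1 - \<delta>\<^sup>2"
    using u by (simp add: q_def)
  have beta: "dln_beta \<delta> t n 2 = (1 + q + \<epsilon>\<^sup>2 * (\<delta> * q) + \<delta>) / 4"
    "dln_beta \<delta> t n 0 = (1 + q - \<epsilon>\<^sup>2 * (\<delta> * q) - \<delta>) / 4"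
    by (simp_all add: dln_beta_def Let_def q_def u_def \<epsilon>_def)
  \<comment> \<open>The terms with \<open>q\<close> collect to a multiple of \<open>q * (\<epsilon>
    + \<epsilon>\<^sup>2 * \<delta>) = q * \<epsilon> * u\<close>. The factor \<open>s * u\<close>
    completes this to \<open>q * u\<^sup>2\<close>, which is free of denominators.\<close>
  have "(dln_beta \<delta> t n 2 * k - dln_beta \<delta> t n 0 * m) * (2 * (s * u)) =
      s\<^sup>2 * ((\<delta> + \<epsilon>) * u + \<epsilon> * (q * u\<^sup>2))"
    unfolding beta k m u_def by (simp add: field_simps power2_eq_square)
  also have "\<dots> = dln_alpha \<delta> 2 * k ^ 2 + dln_alpha \<delta> 0 * m ^ 2"
    unfolding qu unfolding k m u_def by (simp add: dln_alpha_def field_simps power2_eq_square)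
  finally show ?thesis
    using s u by (simp add: avg k_def m_def field_simps)
qed

text \<open>Here \<open>c\<close> plays the role of the offset of the one-leg time from the middle
  grid point. The first two bounds keep that time between the outer grid points; the third makes the
  bracket positive.\<close>

lemma weighted_square_bounds:
  fixes a b k m c :: real
  assumes "a > 0" "b \<ge> 0" "k > 0" "m > 0"
    and c: "c = (a * k\<^sup>2 - b * m\<^sup>2) / (2 * (a * k + b * m))"
  shows "- m \<le> c" "c \<le> k" "c\<^sup>2 \<le> (a * k ^ 3 + b * m ^ 3) / (a * k + b * m) / 4"
proof -
  define d where "d = a * k + b * m"
  have d: "d > 0" using assms by (simp add: d_def add_pos_nonneg)
  have cd: "c * (2 * d) = a * k\<^sup>2 - b * m\<^sup>2"
    using c d by (simp add: d_def[symmetric])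
  have nonneg: "0 \<le> a * k\<^sup>2" "0 \<le> b * m\<^sup>2" "0 \<le> a * (k * m)" "0 \<le> b * (k * m)"
    using assms by auto
  have "- m * (2 * d) \<le> a * k\<^sup>2 - b * m\<^sup>2"
    using nonneg by (simp add: d_def algebra_simps power2_eq_square)
  then show "- m \<le> c"
    unfolding cd[symmetric] by (rule mult_right_le_imp_le) (use d in simp)
  have "a * k\<^sup>2 - b * m\<^sup>2 \<le> k * (2 * d)"
    using nonneg by (simp add: d_def algebra_simps power2_eq_square)
  then show "c \<le> k"
    unfolding cd[symmetric] by (rule mult_right_le_imp_le) (use d in simp)
  \<comment> \<open>The added term is exactly the gap in the Cauchy-Schwarz inequality.\<close>
  have "(a * k\<^sup>2 - b * m\<^sup>2)\<^sup>2 \<le> (a * k\<^sup>2 - b * m\<^sup>2)\<^sup>2 + a * b * k * m * (k + m)\<^sup>2"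
    using assms by simp
  also have "\<dots> = (a * k ^ 3 + b * m ^ 3) * d"
    by (simp add: d_def algebra_simps power2_eq_square power3_eq_cube)
  finally have "4 * c\<^sup>2 * d * d \<le> (a * k ^ 3 + b * m ^ 3) * d"
    unfolding cd[symmetric] by (simp add: power2_eq_square algebra_simps)
  then have "4 * c\<^sup>2 * d \<le> a * k ^ 3 + b * m ^ 3"
    using d by (simp add: mult_le_cancel_right)
  then show "c\<^sup>2 \<le> (a * k ^ 3 + b * m ^ 3) / (a * k + b * m) / 4"
    using d by (simp add: d_def[symmetric] field_simps)
qed

text \<open>The leading term relation is made precise as an error below any prescribed multiple of
  the bracket. The threshold \<open>h\<close> is chosen before the grid and the index, so the
  estimate is uniform in both.\<close>

theorem proposition3p1:
  fixes f :: "real \<Rightarrow> 'a::euclidean_space \<Rightarrow> 'a"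
    and y :: "real \<Rightarrow> 'a" and y0 :: 'a
    and D :: "nat \<Rightarrow> real \<Rightarrow> 'a"
    and \<delta> T :: real
  assumes "0 \<le> \<delta>" and "\<delta> \<le> 1" and "0 < T"
    and "ivp_solution f y0 T y"
    and "D 0 = y"
    and "\<And>i s. i < 3 \<Longrightarrow> s \<in> {0..T} \<Longrightarrow>
           (D i has_vector_derivative D (Suc i) s) (at s within {0..T})"
    and "continuous_on {0..T} (D 3)"
  shows "(\<forall>t n. n \<ge> 1 \<longrightarrow> dln_lte \<delta> f y t n = diff_defect \<delta> f y t n) \<and>
    (\<forall>\<eta>>0. \<exists>h>0. \<forall>(t :: nat \<Rightarrow> real) n.
       t 0 = 0 \<longrightarrow> strict_mono t \<longrightarrow> n \<ge> 1 \<longrightarrow> t (n + 1) \<le> T \<longrightarrow>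
       time_step t (n - 1) < h \<longrightarrow> time_step t n < h \<longrightarrow>
       norm (diff_defect \<delta> f y t n
              - dln_alpha \<delta> 2 *\<^sub>R ((dln_bracket \<delta> t n / 2) *\<^sub>R D 3 (t n)))
         \<le> \<eta> * dln_bracket \<delta> t n)"
proof (intro conjI allI impI)
  show "dln_lte \<delta> f y t n = diff_defect \<delta> f y t n" for t n
    by (simp add: dln_lte_def dln_residual_def diff_defect_def inverse_eq_divide)
next
  fix \<eta> :: real
  assume \<eta>: "\<eta> > 0"
  have "uniformly_continuous_on {0..T} (D 3)"
    using assms(7) by (rule compact_uniformly_continuous) simp
  \<comment> \<open>The remainders will add up to at most
    \<open>\<eta> / 15 * (Q + c\<^sup>2)\<close>. Since \<open>c\<^sup>2 \<le> Q / 4\<close>, the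
    sum \<open>Q + c\<^sup>2\<close> is at most \<open>5 * Q / 4\<close>, while
    \<open>Q / 3 - c\<^sup>2\<close> is at least \<open>Q / 12\<close>; the ratio is 15.\<close>
  then obtain h where h: "h > 0"
    and modulus: "\<And>s s'. s \<in> {0..T} \<Longrightarrow> s' \<in> {0..T} \<Longrightarrow> dist s' s < h \<Longrightarrow> dist (D 3 s') (D 3 s) < \<eta> / 15"
    using \<eta> unfolding uniformly_continuous_on_def by (metis zero_less_divide_iff zero_less_numeral)
  have "norm (diff_defect \<delta> f y t n
              - dln_alpha \<delta> 2 *\<^sub>R ((dln_bracket \<delta> t n / 2) *\<^sub>R D 3 (t n)))
         \<le> \<eta> * dln_bracket \<delta> t n"
    if t: "t 0 = 0" "strict_mono t" "n \<ge> 1" "t (n + 1) \<le> T"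
      "time_step t (n - 1) < h" "time_step t n < h" for t :: "nat \<Rightarrow> real" and n
  proof -
    define k m where "k = time_step t n" and "m = time_step t (n - 1)"
    define a b where "a = (1 + \<delta>) / 2" and "b = (1 - \<delta>) / 2"
    define x where "x = t n"
    define c where "c = (a * k\<^sup>2 - b * m\<^sup>2) / (2 * (a * k + b * m))"
    define Q where "Q = (a * k ^ 3 + b * m ^ 3) / (a * k + b * m)"
    \<comment> \<open>A convex set that contains all evaluation points and on which
      \<open>D 3\<close> stays within \<open>\<eta> / 15\<close> of its value at
      \<open>x\<close>.\<close>
    define S where "S = {0..T} \<inter> ball x h"
    have alpha: "dln_alpha \<delta> 2 = a" "dln_alpha \<delta> 0 = - b" "dln_alpha \<delta> (Suc 0) = b - a"
      by (simp_all add: dln_alpha_def a_def b_def field_simps)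
    have ab: "a > 0" "a \<le> 1" "b \<ge> 0"
      using assms(1,2) by (auto simp: a_def b_def)
    have grid: "t (n + 1) = x + k" "t (n - 1) = x - m"
      using t(3) by (auto simp: x_def k_def m_def time_step_def)
    have km: "k > 0" "m > 0"
      using t(2,3) by (auto simp: k_def m_def time_step_def strict_mono_def)
    have avg: "avg_step \<delta> t n = a * k + b * m"
      by (simp add: avg_step_def alpha k_def m_def)
    have pos: "a * k + b * m > 0"
      using ab km by (simp add: add_pos_nonneg)
    have offset: "dln_beta \<delta> t n 2 * k - dln_beta \<delta> t n 0 * m = c"
      using dln_offset[OF assms(1,2), of t n, folded k_def m_def] km by (simp add: c_def alpha avg)
    have time: "dln_time \<delta> t n = x + c"
      using dln_time_eq[OF t(3)] offset by (simp add: x_def k_def m_def)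
    note c_bounds = weighted_square_bounds[OF ab(1,3) km c_def]
    have c2: "c\<^sup>2 \<le> Q / 4"
      using c_bounds(3) by (simp add: Q_def)
    \<comment> \<open>Half of the right-hand side is the difference of the third derivative
      coefficients \<open>Q / 6\<close> of the difference quotient and \<open>c\<^sup>2 / 2\<close>
      of the derivative at \<open>x + c\<close>.\<close>
    have bracket: "a * dln_bracket \<delta> t n = Q / 3 - c\<^sup>2"
    proof -
      have "a * (1 / (3 * g) * (k ^ 3 - - b / a * m ^ 3) - 1 / a * c\<^sup>2) =
          (a * k ^ 3 + b * m ^ 3) / g / 3 - c\<^sup>2" if "g > 0" for g
        using ab(1) that by (simp add: field_simps)
      from this[OF pos] show ?thesis
        unfolding dln_bracket_def k_def[symmetric] m_def[symmetric] offset alpha avg Q_def .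
    qed
    then have Q: "Q / 6 = a * dln_bracket \<delta> t n / 2 + c\<^sup>2 / 2"
      by argo
    have "0 \<le> t (n - 1)"
      using t(1,2) by (metis strict_mono_less_eq zero_le)
    then have mem: "x \<in> S" "x + k \<in> S" "x - m \<in> S" "x + c \<in> S"
      using t(4) t(5,6)[folded k_def m_def] km c_bounds(1,2) h grid
      by (auto simp: S_def dist_real_def)
    have deriv: "(D i has_vector_derivative D (Suc i) s) (at s within S)" if "i < 3" "s \<in> S" for i s
      using assms(6)[of i s] that by (auto simp: S_def intro: has_vector_derivative_within_subset)
    have osc: "norm (D 3 s - D 3 x) \<le> \<eta> / 15" if "s \<in> S" for s
      using modulus[of x s] that mem(1) by (auto simp: S_def dist_commute dist_norm)
    have S: "convex S"
      by (simp add: S_def convex_Int)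
    define R where "R z = y z - (y x + (z - x) *\<^sub>R D 1 x + ((z - x)\<^sup>2 / 2) *\<^sub>R D 2 x
      + ((z - x) ^ 3 / 6) *\<^sub>R D 3 x)" for z
    define R' where "R' = D 1 (x + c) - (D 1 x + c *\<^sub>R D 2 x + (c\<^sup>2 / 2) *\<^sub>R D 3 x)"
    have R: "norm (R z) \<le> \<eta> / 15 * \<bar>z - x\<bar> ^ 3" if "z \<in> S" for z
      using Taylor_bound_convex[of S x z 3 D, OF S mem(1) that deriv osc] assms(5)
      by (simp add: R_def numeral_3_eq_3 numeral_2_eq_2)
    \<comment> \<open>Taylor expansion of the first derivative to order two: the chain shifted by
      one has the same top function \<open>D 3\<close>.\<close>
    have R': "norm R' \<le> \<eta> / 15 * c\<^sup>2"
      using Taylor_bound_convex[of S x "x + c" 2 "\<lambda>i. D (Suc i)" "\<eta> / 15", OF S mem(1,4)] deriv osc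
      by (simp add: R'_def numeral_3_eq_3 numeral_2_eq_2)
    have "x + c \<in> {0..T}"
      using mem(4) by (simp add: S_def)
    \<comment> \<open>Both sides are derivatives of \<open>y\<close> within \<open>{0..T}\<close>,
      and these are unique because the interval is nondegenerate.\<close>
    then have ode: "f (x + c) (y (x + c)) = D 1 (x + c)"
      using assms(4) assms(6)[of 0 "x + c"] assms(3,5)
      by (intro vector_derivative_unique_within_closed_interval[of 0 T "x + c" y])
        (auto simp: ivp_solution_def)
    have "diff_defect \<delta> f y t n =
        (1 / (a * k + b * m)) *\<^sub>R (a *\<^sub>R y (x + k) + (b - a) *\<^sub>R y x - b *\<^sub>R y (x - m)) - D 1 (x + c)"
      using t(3) grid ode by (simp add: diff_defect_def sum_le_2 alpha avg time x_def)
    \<comment> \<open>The values \<open>y x\<close> cancel because the weights \<open>a\<close>,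
      \<open>b - a\<close>, \<open>- b\<close> sum to zero.\<close>
    also have "a *\<^sub>R y (x + k) + (b - a) *\<^sub>R y x - b *\<^sub>R y (x - m) =
        a *\<^sub>R R (x + k) - b *\<^sub>R R (x - m) + (a * k + b * m) *\<^sub>R D 1 x
        + ((a * k\<^sup>2 - b * m\<^sup>2) / 2) *\<^sub>R D 2 x + ((a * k ^ 3 + b * m ^ 3) / 6) *\<^sub>R D 3 x"
      by (simp add: R_def algebra_simps add_divide_distrib diff_divide_distrib)
    \<comment> \<open>The coefficient of \<open>D 2 x\<close> becomes \<open>c\<close>, the same as
      in the expansion of \<open>D 1 (x + c)\<close>, so the second order terms cancel in the next
      step.\<close>
    also have "(1 / (a * k + b * m)) *\<^sub>R \<dots> =
        (1 / (a * k + b * m)) *\<^sub>R (a *\<^sub>R R (x + k) - b *\<^sub>R R (x - m)) + D 1 x + c *\<^sub>R D 2 x + (Q / 6) *\<^sub>R D 3 x"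
      using pos by (simp add: scaleR_add_right c_def Q_def mult.commute)
    finally have "diff_defect \<delta> f y t n - a *\<^sub>R ((dln_bracket \<delta> t n / 2) *\<^sub>R D 3 x) =
        (1 / (a * k + b * m)) *\<^sub>R (a *\<^sub>R R (x + k) - b *\<^sub>R R (x - m)) - R'"
      by (simp add: R'_def Q algebra_simps)
    also have "norm \<dots> \<le> \<eta> / 15 * (Q + c\<^sup>2)"
    proof -
      have "norm (a *\<^sub>R R (x + k) - b *\<^sub>R R (x - m)) \<le> a * norm (R (x + k)) + b * norm (R (x - m))"
        using norm_triangle_ineq4[of "a *\<^sub>R R (x + k)" "b *\<^sub>R R (x - m)"] ab by simp
      also have "\<dots> \<le> a * (\<eta> / 15 * k ^ 3) + b * (\<eta> / 15 * m ^ 3)"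
        using R[OF mem(2)] R[OF mem(3)] ab km by (intro add_mono mult_left_mono) auto
      also have "\<dots> = \<eta> / 15 * Q * (a * k + b * m)"
        using pos by (simp add: Q_def field_simps)
      finally have "norm ((1 / (a * k + b * m)) *\<^sub>R (a *\<^sub>R R (x + k) - b *\<^sub>R R (x - m))) \<le> \<eta> / 15 * Q"
        using pos by (simp add: divide_le_eq)
      then show ?thesis
        using R' unfolding distrib_left by (intro norm_triangle_le_diff add_mono)
    qed
    \<comment> \<open>By \<open>bracket\<close> this amounts to
      \<open>Q + c\<^sup>2 \<le> 5 * Q - 15 * c\<^sup>2\<close>, which is
      \<open>c\<^sup>2 \<le> Q / 4\<close>.\<close>
    also have "\<dots> \<le> \<eta> / 15 * (15 * (a * dln_bracket \<delta> t n))"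
      using c2 bracket \<eta> by (intro mult_left_mono) auto
    also have "\<dots> \<le> \<eta> * dln_bracket \<delta> t n"
    proof -
      have "0 \<le> a * dln_bracket \<delta> t n"
        using c2 bracket zero_le_power2[of c] by linarith
      then have "0 \<le> dln_bracket \<delta> t n"
        using ab by (simp add: zero_le_mult_iff)
      then show ?thesis
        using ab \<eta> by (simp add: mult_left_le_one_le)
    qed
    finally show ?thesis
      by (simp add: alpha x_def)
  qed
  with h show "\<exists>h>0. \<forall>(t :: nat \<Rightarrow> real) n.
       t 0 = 0 \<longrightarrow> strict_mono t \<longrightarrow> n \<ge> 1 \<longrightarrow> t (n + 1) \<le> T \<longrightarrow>
       time_step t (n - 1) < h \<longrightarrow> time_step t n < h \<longrightarrow>
       norm (diff_defect \<delta> f y t n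
              - dln_alpha \<delta> 2 *\<^sub>R ((dln_bracket \<delta> t n / 2) *\<^sub>R D 3 (t n)))
         \<le> \<eta> * dln_bracket \<delta> t n"
    by blast
qed

end
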